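(* Let $n\ge 3$ and let $P_1=(x_1,y_1),\dots,P_n=(x_n,y_n)$ be $n$ points in $\mathbb{R}^2$ such that the sequence $(x_i)_{i=1}^n$ is strictly increasing and concave, while the sequence $(y_i)_{i=1}^n$ is increasing and convex. Then the segments $\overline{P_1P_2},\dots,\overline{P_{n-1}P_n},\overline{P_nP_1}$ form a convex polygon.
   Context: A finite real sequence $(u_i)_{i=1}^n$ is convex if $2u_i\le u_{i-1}+u_{i+1}$ for all $2\le i\le n-1$, and concave if the reverse inequality holds for all such $i$. "Increasing" means non-decreasing ($u_i\le u_{i+1}$). $\overline{PQ}$ denotes the closed line segment with endpoints $P,Q$. The segments $\overline{P_1P_2},\dots,\overline{P_{n-1}P_n},\overline{P_nP_1}$ are said to form a convex polygon if their union equals the topological boundary (in $\mathbb{R}^2$) of the convex hull of $\{P_1,\dots,P_n\}$. Degenerate cases are allowed: consecutive vertices may be collinear with their neighbours, and all points may even lie on one line, in which case the convex hull is a segment equal to its own boundary. *)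

theory Defs
  imports "HOL-Analysis.Analysis"
begin

text \<open>
  A finite sequence with terms indexed by 1, ..., n is a function on \<^typ>\<open>nat\<close> of which only the
  values on \<open>{1..n}\<close> matter.
\<close>

definition convex_seq :: "nat \<Rightarrow> (nat \<Rightarrow> real) \<Rightarrow> bool" where
  "convex_seq n u \<longleftrightarrow> (\<forall>i\<in>{2..n-1}. 2 * u i \<le> u (i - 1) + u (i + 1))"

definition concave_seq :: "nat \<Rightarrow> (nat \<Rightarrow> real) \<Rightarrow> bool" where
  "concave_seq n u \<longleftrightarrow> (\<forall>i\<in>{2..n-1}. 2 * u i \<ge> u (i - 1) + u (i + 1))"

text \<open>
  The topological boundary is taken in the plane, so when all the points lie on one line the convex
  hull is its own frontier; such degenerate polygons are allowed.
\<close>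

definition forms_convex_polygon :: "nat \<Rightarrow> (nat \<Rightarrow> real \<times> real) \<Rightarrow> bool" where
  "forms_convex_polygon n P \<longleftrightarrow>
     (\<Union>i\<in>{1..n-1}. closed_segment (P i) (P (i + 1))) \<union> closed_segment (P n) (P 1)
       = frontier (convex hull (P ` {1..n}))"

end

theory Submission
  imports Defs
begin

text \<open>
  Because the increments of \<open>x\<close> are positive and decreasing while those of \<open>y\<close> are nonnegative and
  increasing, the slopes of the edges \<open>P\<^sub>iP\<^sub>i\<^sub>+\<^sub>1\<close> increase with \<open>i\<close>.
  Increasing slopes mean that over its own edge no edge line lies below another edge line, so
  the polygonal path is the graph of the maximum \<open>f\<close> of finitely many
  affine functions, which is convex and continuous (\<open>chain_fun_eq_line\<close>,
  \<open>convex_on_chain_fun\<close>).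

  Let \<open>g\<close> be the affine function whose graph contains the closing segment \<open>P\<^sub>nP\<^sub>1\<close>. The region between
  the graphs of \<open>f\<close> and \<open>g\<close> is convex and contains all the vertices; conversely each of its points
  lies on a vertical segment joining a point of the path to a point of the closing segment. So this
  region is the convex hull of the vertices (\<open>convex_hull_chain\<close>). Since \<open>f\<close> and \<open>g\<close> agree at both
  ends of the interval, the frontier of the region consists of the two graphs
  (\<open>frontier_between_graphs\<close>), which are the path and the closing segment. The argument also covers
  collinear vertices, where \<open>f = g\<close> on the interval and the region has empty interior.
\<close>

section \<open>Regions between two graphs\<close>

definition between_graphs :: "real set \<Rightarrow> (real \<Rightarrow> real) \<Rightarrow> (real \<Rightarrow> real) \<Rightarrow> (real \<times> real) set" where
  "between_graphs I f g = {p. fst p \<in> I \<and> f (fst p) \<le> snd p \<and> snd p \<le> g (fst p)}"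

lemma convex_between_graphs:
  assumes "convex_on I f" and "concave_on I g"
  shows "convex (between_graphs I f g)"
proof (rule convexI)
  fix p q :: "real \<times> real" and u v :: real
  assume p: "p \<in> between_graphs I f g" and q: "q \<in> between_graphs I f g"
    and uv: "u \<ge> 0" "v \<ge> 0" "u + v = 1"
  have I: "fst p \<in> I" "fst q \<in> I"
    using p q by (auto simp: between_graphs_def)
  have "u * fst p + v * fst q \<in> I"
    using convexD[OF convex_on_imp_convex[OF assms(1)] I uv] by simp
  moreover have "f (u * fst p + v * fst q) \<le> u * snd p + v * snd q"
  proof -
    have "f (u * fst p + v * fst q) \<le> u * f (fst p) + v * f (fst q)"
      using assms(1) I uv by (simp add: convex_on_def)
    also have "\<dots> \<le> u * snd p + v * snd q"
      using p q uv by (intro add_mono mult_left_mono) (auto simp: between_graphs_def)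
    finally show ?thesis .
  qed
  moreover have "u * snd p + v * snd q \<le> g (u * fst p + v * fst q)"
  proof -
    have "u * snd p + v * snd q \<le> u * g (fst p) + v * g (fst q)"
      using p q uv by (intro add_mono mult_left_mono) (auto simp: between_graphs_def)
    also have "\<dots> \<le> g (u * fst p + v * fst q)"
      using assms(2) I uv by (simp add: concave_on_iff)
    finally show ?thesis .
  qed
  ultimately show "u *\<^sub>R p + v *\<^sub>R q \<in> between_graphs I f g"
    by (simp add: between_graphs_def)
qed

text \<open>
  A point off the graphs and strictly between the endpoints is interior by continuity; a point of a
  graph can be pushed out vertically. Over an endpoint of the interval the region is a single point,
  because the two functions agree there, and that point already lies on the graphs.
\<close>
lemma frontier_between_graphs:
  fixes f g :: "real \<Rightarrow> real"
  assumes cont: "continuous_on {c..d} f" "continuous_on {c..d} g"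
    and le: "\<And>t. t \<in> {c..d} \<Longrightarrow> f t \<le> g t"
    and ends: "f c = g c" "f d = g d"
  shows "frontier (between_graphs {c..d} f g)
    = (\<lambda>t. (t, f t)) ` {c..d} \<union> (\<lambda>t. (t, g t)) ` {c..d}"
proof -
  define K where "K = between_graphs {c..d} f g"
  define U where "U = {p. fst p \<in> {c<..<d} \<and> f (fst p) < snd p \<and> snd p < g (fst p)}"
  have contS: "continuous_on S (\<lambda>p::real\<times>real. f (fst p))" "continuous_on S (\<lambda>p::real\<times>real. g (fst p))"
    if "fst ` S \<subseteq> {c..d}" for S :: "(real \<times> real) set"
    using that by (auto intro!: continuous_on_compose2[OF cont(1)] continuous_on_compose2[OF cont(2)]
      continuous_intros)
  have "closed K"
  proof -
    let ?S = "{c..d} \<times> (UNIV :: real set)"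
    have S: "closed ?S" "fst ` ?S \<subseteq> {c..d}" by (auto intro: closed_Times)
    have "K = {p \<in> ?S. f (fst p) \<le> snd p} \<inter> {p \<in> ?S. snd p \<le> g (fst p)}"
      by (auto simp: K_def between_graphs_def)
    moreover have "closed {p \<in> ?S. f (fst p) \<le> snd p}" "closed {p \<in> ?S. snd p \<le> g (fst p)}"
      by (intro continuous_on_closed_Collect_le contS S continuous_intros)+
    ultimately show ?thesis by auto
  qed
  moreover have "interior K = U"
  proof
    have "open U"
    proof -
      let ?S = "{c<..<d} \<times> (UNIV :: real set)"
      have S: "open ?S" "fst ` ?S \<subseteq> {c..d}" by (auto intro: open_Times)
      have "U = (?S \<inter> (\<lambda>p. snd p - f (fst p)) -` {0<..}) \<inter> (?S \<inter> (\<lambda>p. g (fst p) - snd p) -` {0<..})"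
        by (auto simp: U_def)
      moreover have "open (?S \<inter> (\<lambda>p. snd p - f (fst p)) -` {0<..})"
        "open (?S \<inter> (\<lambda>p. g (fst p) - snd p) -` {0<..})"
        by (intro continuous_open_preimage continuous_intros contS S open_greaterThan)+
      ultimately show ?thesis by auto
    qed
    moreover have "U \<subseteq> K" by (auto simp: U_def K_def between_graphs_def)
    ultimately show "U \<subseteq> interior K" by (rule interior_maximal[rotated])
    show "interior K \<subseteq> U"
    proof
      fix p assume p: "p \<in> interior K"
      then obtain e where e: "e > 0" "cball p e \<subseteq> K"
        by (auto simp: mem_interior_cball)
      have pK: "p \<in> K" using p interior_subset by auto
      have "(fst p, snd p + e) \<in> K" "(fst p, snd p - e) \<in> K"
        using e by (auto intro!: subsetD[OF e(2)] simp: dist_prod_def dist_real_def)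
      then have "f (fst p) < snd p" "snd p < g (fst p)"
        using e(1) by (auto simp: K_def between_graphs_def)
      then show "p \<in> U"
        using pK ends by (cases "fst p = c \<or> fst p = d") (auto simp: U_def K_def between_graphs_def)
    qed
  qed
  ultimately have "frontier K = K - U"
    by (simp add: frontier_def)
  also have "\<dots> = (\<lambda>t. (t, f t)) ` {c..d} \<union> (\<lambda>t. (t, g t)) ` {c..d}" (is "_ = ?G")
  proof
    show "?G \<subseteq> K - U" using le by (auto simp: K_def U_def between_graphs_def)
    show "K - U \<subseteq> ?G"
    proof
      fix p assume p: "p \<in> K - U"
      obtain a b where ab: "p = (a, b)" by (cases p)
      have K: "a \<in> {c..d}" "f a \<le> b" "b \<le> g a"
        using p by (auto simp: ab K_def between_graphs_def)
      have "b = f a \<or> b = g a"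
      proof (cases "a = c \<or> a = d")
        case True
        then show ?thesis using K ends by auto
      next
        case False
        then show ?thesis using p K by (auto simp: ab U_def)
      qed
      then show "p \<in> ?G" using K(1) by (auto simp: ab)
    qed
  qed
  finally show ?thesis by (simp add: K_def)
qed

section \<open>Lines through two points\<close>

definition slope :: "real \<times> real \<Rightarrow> real \<times> real \<Rightarrow> real" where
  "slope p q = (snd q - snd p) / (fst q - fst p)"

definition line_through :: "real \<times> real \<Rightarrow> real \<times> real \<Rightarrow> real \<Rightarrow> real" where
  "line_through p q t = snd p + slope p q * (t - fst p)"

lemma line_through_left [simp]: "line_through p q (fst p) = snd p"
  by (simp add: line_through_def)

lemma line_through_right:
  assumes "fst p \<noteq> fst q"
  shows "line_through p q (fst q) = snd q"
  using assms by (simp add: line_through_def slope_def)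

lemma line_through_convex_combination:
  assumes "u + v = 1"
  shows "line_through p q (u * s + v * t) = u * line_through p q s + v * line_through p q t"
proof -
  have u: "u = 1 - v" using assms by simp
  show ?thesis unfolding line_through_def u by (simp add: algebra_simps)
qed

lemma convex_on_line_through: "convex S \<Longrightarrow> convex_on S (line_through p q)"
  by (auto simp: convex_on_def line_through_convex_combination)

lemma concave_on_line_through: "convex S \<Longrightarrow> concave_on S (line_through p q)"
  by (auto simp: concave_on_iff line_through_convex_combination)

lemma continuous_on_line_through: "continuous_on S (line_through p q)"
  unfolding line_through_def by (intro continuous_intros)

lemma closed_segment_eq_graph:
  assumes "fst p < fst q"
  shows "closed_segment p q = (\<lambda>t. (t, line_through p q t)) ` {fst p..fst q}"
proof -
  have on_line: "(1 - u) *\<^sub>R p + u *\<^sub>R q = (s, line_through p q s)"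
    if "s = (1 - u) * fst p + u * fst q" for u s
    using assms line_through_convex_combination[of "1 - u" u p q "fst p" "fst q"]
    by (simp add: that line_through_right prod_eq_iff)
  show ?thesis
  proof (intro equalityI subsetI)
    fix r assume "r \<in> closed_segment p q"
    then obtain u where u: "0 \<le> u" "u \<le> 1" "r = (1 - u) *\<^sub>R p + u *\<^sub>R q"
      by (auto simp: in_segment)
    have "(1 - u) * fst p + u * fst q \<in> closed_segment (fst p) (fst q)"
      using u by (auto simp: in_segment)
    then show "r \<in> (\<lambda>t. (t, line_through p q t)) ` {fst p..fst q}"
      using assms on_line[OF refl, of u] u(3) by (auto simp: closed_segment_eq_real_ivl)
  next
    fix r assume "r \<in> (\<lambda>t. (t, line_through p q t)) ` {fst p..fst q}"
    then obtain s where s: "s \<in> closed_segment (fst p) (fst q)" "r = (s, line_through p q s)"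
      using assms by (auto simp: closed_segment_eq_real_ivl)
    then obtain u where "0 \<le> u" "u \<le> 1" "s = (1 - u) * fst p + u * fst q"
      by (auto simp: in_segment)
    then show "r \<in> closed_segment p q"
      using on_line s(2) by (auto simp: in_segment)
  qed
qed

text \<open>
  Consecutive edge lines of a path meet at the common vertex, so the sign of their difference is that
  of the change of slope times the horizontal offset from the vertex.
\<close>
lemma line_through_diff:
  assumes "fst p \<noteq> fst q"
  shows "line_through q r t - line_through p q t = (slope q r - slope p q) * (t - fst q)"
proof -
  have "slope p q * (fst q - fst p) = snd q - snd p"
    using assms by (simp add: slope_def)
  then show ?thesis unfolding line_through_def by (simp add: algebra_simps)
qed

section \<open>Polygonal chains with increasing slopes\<close>

text \<open>
  The pointwise maximum of the edge lines rather than a case distinction over the edges: in this form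
  convexity is immediate, and no interpolation formula is needed.
\<close>
definition chain_fun :: "nat \<Rightarrow> (nat \<Rightarrow> real \<times> real) \<Rightarrow> real \<Rightarrow> real" where
  "chain_fun n P t = (MAX i\<in>{1..<n}. line_through (P i) (P (Suc i)) t)"

lemma convex_on_chain_fun:
  assumes "n \<ge> 2" "convex S"
  shows "convex_on S (chain_fun n P)"
proof -
  let ?l = "\<lambda>i. line_through (P i) (P (Suc i))"
  have ne: "{1..<n} \<noteq> {}" using assms(1) by auto
  have le: "?l i t \<le> chain_fun n P t" if "i \<in> {1..<n}" for i t
    unfolding chain_fun_def using that by (intro Max_ge) auto
  have "chain_fun n P (u * s + v * t) \<le> u * chain_fun n P s + v * chain_fun n P t"
    if uv: "u \<ge> 0" "v \<ge> 0" "u + v = 1" for u v s t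
  proof -
    have "?l i (u * s + v * t) \<le> u * chain_fun n P s + v * chain_fun n P t" if "i \<in> {1..<n}" for i
      using uv le[OF that] by (simp add: line_through_convex_combination add_mono mult_left_mono)
    then show ?thesis
      using ne by (subst chain_fun_def) (auto intro!: Max.boundedI)
  qed
  then show ?thesis using assms(2) by (simp add: convex_on_def)
qed

lemma continuous_on_chain_fun:
  assumes "n \<ge> 2"
  shows "continuous_on S (chain_fun n P)"
  using convex_on_continuous[OF open_UNIV convex_on_chain_fun[OF assms convex_UNIV]]
  by (rule continuous_on_subset) auto

locale convex_chain =
  fixes n :: nat and P :: "nat \<Rightarrow> real \<times> real"
  assumes two_le: "n \<ge> 2"
    and fst_strict_mono: "strict_mono_on {1..n} (\<lambda>i. fst (P i))"
    and slope_le_Suc: "\<And>i. \<lbrakk>1 \<le> i; Suc i < n\<rbrakk>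
      \<Longrightarrow> slope (P i) (P (Suc i)) \<le> slope (P (Suc i)) (P (Suc (Suc i)))"
begin

abbreviation edge_line :: "nat \<Rightarrow> real \<Rightarrow> real" where
  "edge_line i \<equiv> line_through (P i) (P (Suc i))"

abbreviation base_line :: "real \<Rightarrow> real" where
  "base_line \<equiv> line_through (P 1) (P n)"

lemma fst_less: "\<lbrakk>1 \<le> i; i < j; j \<le> n\<rbrakk> \<Longrightarrow> fst (P i) < fst (P j)"
  using strict_mono_onD[OF fst_strict_mono, of i j] by auto

lemma fst_le: "\<lbrakk>1 \<le> i; i \<le> j; j \<le> n\<rbrakk> \<Longrightarrow> fst (P i) \<le> fst (P j)"
  using fst_less[of i j] by (cases "i = j") auto

lemma edge_line_step:
  assumes "1 \<le> i" "Suc i < n"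
  shows "fst (P (Suc i)) \<le> t \<Longrightarrow> edge_line i t \<le> edge_line (Suc i) t"
    and "t \<le> fst (P (Suc i)) \<Longrightarrow> edge_line (Suc i) t \<le> edge_line i t"
proof -
  have diff: "edge_line (Suc i) t - edge_line i t
      = (slope (P (Suc i)) (P (Suc (Suc i))) - slope (P i) (P (Suc i))) * (t - fst (P (Suc i)))"
    using fst_less[of i "Suc i"] assms by (intro line_through_diff) auto
  have slope: "0 \<le> slope (P (Suc i)) (P (Suc (Suc i))) - slope (P i) (P (Suc i))"
    using slope_le_Suc[OF assms] by simp
  show "edge_line i t \<le> edge_line (Suc i) t" if "fst (P (Suc i)) \<le> t"
    using mult_nonneg_nonneg[OF slope, of "t - fst (P (Suc i))"] that diff by simp
  show "edge_line (Suc i) t \<le> edge_line i t" if "t \<le> fst (P (Suc i))"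
    using mult_nonneg_nonpos[OF slope, of "t - fst (P (Suc i))"] that diff by simp
qed

text \<open>
  Passing from the edge over \<open>t\<close> to a farther edge, on either side, crosses vertices that all lie on
  the same side of \<open>t\<close>, and each crossing can only lower the value of the edge line at \<open>t\<close>.
\<close>
lemma edge_line_le_own:
  assumes j: "1 \<le> j" "j < n" and t: "t \<in> {fst (P j)..fst (P (Suc j))}" and i: "1 \<le> i" "i < n"
  shows "edge_line i t \<le> edge_line j t"
proof (cases "i \<le> j")
  case True
  then show ?thesis
    using i(1)
  proof (induction i rule: inc_induct)
    case (step k)
    have "fst (P (Suc k)) \<le> fst (P j)"
      using step j by (intro fst_le) auto
    then have "edge_line k t \<le> edge_line (Suc k) t"
      using step j t by (intro edge_line_step) auto
    then show ?case using step by simp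
  qed simp
next
  case False
  then have "j \<le> i" by simp
  then show ?thesis
    using i(2)
  proof (induction i rule: dec_induct)
    case (step k)
    have "fst (P (Suc j)) \<le> fst (P (Suc k))"
      using step j by (intro fst_le) auto
    then have "edge_line (Suc k) t \<le> edge_line k t"
      using step j t by (intro edge_line_step) auto
    then show ?case using step by simp
  qed simp
qed

lemma chain_fun_eq_line:
  assumes "1 \<le> j" "j < n" "t \<in> {fst (P j)..fst (P (Suc j))}"
  shows "chain_fun n P t = edge_line j t"
  unfolding chain_fun_def
  using assms edge_line_le_own[OF assms] by (intro Max_eqI) auto

lemma chain_fun_vertex:
  assumes "1 \<le> j" "j \<le> n"
  shows "chain_fun n P (fst (P j)) = snd (P j)"
proof (cases "j = n")
  case False
  then show ?thesis
    using assms chain_fun_eq_line[of j "fst (P j)"] fst_less[of j "Suc j"] by auto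
next
  case True
  obtain k where k: "n = Suc k" "1 \<le> k" using two_le by (cases n) auto
  then show ?thesis
    using True chain_fun_eq_line[of k "fst (P n)"] fst_less[of k "Suc k"]
    by (auto simp: line_through_right)
qed

lemma interval_covered_by_edges:
  assumes "t \<in> {fst (P 1)..fst (P n)}"
  obtains j where "1 \<le> j" "j < n" "t \<in> {fst (P j)..fst (P (Suc j))}"
proof -
  \<comment> \<open>The last edge that starts at or before \<open>t\<close>.\<close>
  let ?J = "{j \<in> {1..<n}. fst (P j) \<le> t}"
  define j where "j = Max ?J"
  have "1 \<in> ?J" using assms two_le by auto
  then have "?J \<noteq> {}" by blast
  then have j: "j \<in> ?J" unfolding j_def by (intro Max_in) auto
  have "t \<le> fst (P (Suc j))"
  proof (cases "Suc j = n")
    case True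
    then show ?thesis using assms by auto
  next
    case False
    have "k \<le> j" if "k \<in> ?J" for k
      unfolding j_def using that by (intro Max_ge) auto
    from this[of "Suc j"] have "Suc j \<notin> ?J" by auto
    then show ?thesis using False j by auto
  qed
  then show ?thesis using that j by auto
qed

lemma path_eq_graph:
  "(\<Union>i\<in>{1..<n}. closed_segment (P i) (P (Suc i)))
    = (\<lambda>t. (t, chain_fun n P t)) ` {fst (P 1)..fst (P n)}" (is "?L = ?R")
proof -
  have seg: "closed_segment (P i) (P (Suc i))
      = (\<lambda>t. (t, chain_fun n P t)) ` {fst (P i)..fst (P (Suc i))}" if "i \<in> {1..<n}" for i
    using that fst_less[of i "Suc i"] chain_fun_eq_line[of i]
    by (subst closed_segment_eq_graph) (auto intro!: image_cong)
  have "(\<Union>i\<in>{1..<n}. {fst (P i)..fst (P (Suc i))}) = {fst (P 1)..fst (P n)}"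
  proof
    show "{fst (P 1)..fst (P n)} \<subseteq> (\<Union>i\<in>{1..<n}. {fst (P i)..fst (P (Suc i))})"
    proof
      fix t assume "t \<in> {fst (P 1)..fst (P n)}"
      then obtain j where "1 \<le> j" "j < n" "t \<in> {fst (P j)..fst (P (Suc j))}"
        by (rule interval_covered_by_edges)
      then show "t \<in> (\<Union>i\<in>{1..<n}. {fst (P i)..fst (P (Suc i))})"
        by (intro UN_I[of j]) auto
    qed
    have "{fst (P i)..fst (P (Suc i))} \<subseteq> {fst (P 1)..fst (P n)}" if "i \<in> {1..<n}" for i
      using that fst_le[of 1 i] fst_le[of "Suc i" n] by auto
    then show "(\<Union>i\<in>{1..<n}. {fst (P i)..fst (P (Suc i))}) \<subseteq> {fst (P 1)..fst (P n)}"
      by blast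
  qed
  then show ?thesis using seg by (simp add: image_UN[symmetric])
qed

lemma base_eq_graph:
  "closed_segment (P 1) (P n) = (\<lambda>t. (t, base_line t)) ` {fst (P 1)..fst (P n)}"
  using fst_less[of 1 n] two_le by (intro closed_segment_eq_graph) auto

lemma base_line_ends: "base_line (fst (P 1)) = snd (P 1)" "base_line (fst (P n)) = snd (P n)"
  using fst_less[of 1 n] two_le by (auto simp: line_through_right)

lemma chain_fun_le_base_line:
  assumes "t \<in> {fst (P 1)..fst (P n)}"
  shows "chain_fun n P t \<le> base_line t"
proof -
  have conv: "convex_on {fst (P 1)..fst (P n)} (chain_fun n P)"
    using two_le by (intro convex_on_chain_fun) auto
  show ?thesis
    using convex_onD_Icc'[OF conv assms] chain_fun_vertex[of 1] chain_fun_vertex[of n] two_le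
    by (simp add: line_through_def slope_def add.commute)
qed

lemma convex_hull_chain:
  "convex hull (P ` {1..n})
    = between_graphs {fst (P 1)..fst (P n)} (chain_fun n P) base_line" (is "?H = ?K")
proof
  show "?H \<subseteq> ?K"
  proof (rule hull_minimal)
    show "convex ?K"
      using two_le by (intro convex_between_graphs convex_on_chain_fun concave_on_line_through) auto
    show "P ` {1..n} \<subseteq> ?K"
    proof
      fix p assume "p \<in> P ` {1..n}"
      then obtain j where j: "j \<in> {1..n}" "p = P j" by auto
      then have I: "fst (P j) \<in> {fst (P 1)..fst (P n)}"
        using fst_le[of 1 j] fst_le[of j n] by auto
      have "chain_fun n P (fst (P j)) = snd (P j)"
        using j by (intro chain_fun_vertex) auto
      then show "p \<in> ?K"
        using I chain_fun_le_base_line[OF I] by (simp add: between_graphs_def j)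
    qed
  qed
  show "?K \<subseteq> ?H"
  proof
    fix p assume "p \<in> ?K"
    then obtain a b where p: "p = (a, b)" "a \<in> {fst (P 1)..fst (P n)}"
        "chain_fun n P a \<le> b" "b \<le> base_line a"
      by (cases p) (auto simp: between_graphs_def)
    have vertex: "P i \<in> ?H" if "1 \<le> i" "i \<le> n" for i
      using that by (intro hull_inc) auto
    have "(a, chain_fun n P a) \<in> (\<Union>i\<in>{1..<n}. closed_segment (P i) (P (Suc i)))"
      unfolding path_eq_graph using p by blast
    moreover have "closed_segment (P i) (P (Suc i)) \<subseteq> ?H" if "i \<in> {1..<n}" for i
      using that by (intro closed_segment_subset vertex) auto
    ultimately have low: "(a, chain_fun n P a) \<in> ?H" by blast
    have "(a, base_line a) \<in> closed_segment (P 1) (P n)"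
      unfolding base_eq_graph using p by blast
    moreover have "closed_segment (P 1) (P n) \<subseteq> ?H"
      using two_le by (intro closed_segment_subset vertex) auto
    ultimately have high: "(a, base_line a) \<in> ?H" by blast
    have "b \<in> closed_segment (chain_fun n P a) (base_line a)"
      using p by (auto simp: closed_segment_eq_real_ivl)
    then obtain u where "0 \<le> u" "u \<le> 1" "b = (1 - u) * chain_fun n P a + u * base_line a"
      by (auto simp: in_segment)
    then have "p \<in> closed_segment (a, chain_fun n P a) (a, base_line a)"
      unfolding p(1) in_segment by (intro exI[of _ u]) (simp add: algebra_simps)
    then show "p \<in> ?H"
      using closed_segment_subset[OF low high] by auto
  qed
qed

theorem forms_convex_polygon: "forms_convex_polygon n P"
proof -
  let ?I = "{fst (P 1)..fst (P n)}"
  have "frontier (convex hull (P ` {1..n}))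
      = (\<lambda>t. (t, chain_fun n P t)) ` ?I \<union> (\<lambda>t. (t, base_line t)) ` ?I"
    unfolding convex_hull_chain
    using two_le by (intro frontier_between_graphs continuous_on_chain_fun continuous_on_line_through
        chain_fun_le_base_line) (simp_all add: chain_fun_vertex base_line_ends[simplified])
  also have "\<dots> = (\<Union>i\<in>{1..<n}. closed_segment (P i) (P (Suc i))) \<union> closed_segment (P n) (P 1)"
    by (simp only: path_eq_graph base_eq_graph closed_segment_commute[of "P n"])
  also have "{1..<n} = {1..n - 1}" using two_le by auto
  finally show ?thesis by (simp add: forms_convex_polygon_def)
qed

end

section \<open>Concave abscissae and convex ordinates\<close>

theorem theorem2p3:
  fixes n :: nat and x y :: "nat \<Rightarrow> real"
  assumes "n \<ge> 3"
    and "strict_mono_on {1..n} x" and "concave_seq n x"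
    and "mono_on {1..n} y" and "convex_seq n y"
  shows "forms_convex_polygon n (\<lambda>i. (x i, y i))"
proof (rule convex_chain.forms_convex_polygon, unfold_locales)
  show "n \<ge> 2" using assms(1) by simp
  show "strict_mono_on {1..n} (\<lambda>i. fst (x i, y i))" using assms(2) by simp
  fix i assume i: "1 \<le> i" "Suc i < n"
  let ?j = "Suc i"
  have j: "?j \<in> {2..n - 1}" using i by auto
  have "0 \<le> y ?j - y i"
    using mono_onD[OF assms(4), of i ?j] i by simp
  moreover have "y ?j - y i \<le> y (Suc ?j) - y ?j"
    using bspec[OF assms(5)[unfolded convex_seq_def] j] by simp
  moreover have "0 < x (Suc ?j) - x ?j"
    using strict_mono_onD[OF assms(2), of ?j "Suc ?j"] i by simp
  moreover have "x (Suc ?j) - x ?j \<le> x ?j - x i"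
    using bspec[OF assms(3)[unfolded concave_seq_def] j] by simp
  \<comment> \<open>From one edge to the next the nonnegative rise grows and the positive run shrinks.\<close>
  ultimately have "(y ?j - y i) / (x ?j - x i) \<le> (y (Suc ?j) - y ?j) / (x (Suc ?j) - x ?j)"
    by (intro frac_le) auto
  then show "slope (x i, y i) (x ?j, y ?j) \<le> slope (x ?j, y ?j) (x (Suc ?j), y (Suc ?j))"
    by (simp add: slope_def)
qed

end
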